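(* Let $n$, $k$ and $r$ be positive integers such that $k < \Pi(p_r)$. Then the van der Waerden complex $\mathrm{vdW}(n,k)$ is homotopy equivalent to a CW-complex all of whose cells have dimension at most $r$.
   Context: For positive integers $n,k$, the van der Waerden complex $\mathrm{vdW}(n,k)$ is the (abstract) simplicial complex on the vertex set $[n]=\{1,2,\ldots,n\}$ whose facets correspond to all arithmetic progressions of length $k$ in $[n]$, that is, the sets $\{x, x+d, x+2d, \ldots, x+kd\}$ (having $k+1$ elements) where $d$ is a positive integer and $1\le x<x+kd\le n$. Thus its faces are the empty set, the singletons $\{i\}$ with $i\in[n]$, and all subsets of such progressions. Topological statements refer to its geometric realization. $p_i$ denotes the $i$th prime, and $\Pi(x)=\prod_{p\le x}p$ (product over all primes $p\le x$) is the primorial function; thus $\Pi(p_r)$ is the product of the first $r$ primes. *)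

theory Defs
  imports "HOL-Analysis.Analysis" "HOL-Computational_Algebra.Primes"
begin

definition nth_prime :: "nat \<Rightarrow> nat" where  \<comment> \<open>counted from 1, so \<open>nth_prime 1 = 2\<close>; meant for \<open>i \<ge> 1\<close>\<close>
  "nth_prime i = enumerate {p. prime p} (i - 1)"

definition primorial :: "nat \<Rightarrow> nat" where
  "primorial x = (\<Prod>p | prime p \<and> p \<le> x. p)"

text \<open>The length \<open>k\<close> of a progression is its number of steps, so it has \<open>k + 1\<close> elements. All
  singletons \<open>{i}\<close> with \<open>i\<close> in \<open>{1..n}\<close> are faces, also those that lie on no such progression.\<close>

definition vdW :: "nat \<Rightarrow> nat \<Rightarrow> nat set set" where
  "vdW n k = {{}} \<union> {{i} | i. i \<in> {1..n}} \<union>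
     {F. \<exists>x d. 0 < d \<and> 1 \<le> x \<and> x < x + k * d \<and> x + k * d \<le> n \<and> F \<subseteq> {x + j * d | j. j \<le> k}}"

text \<open>Points of the realization are given by their barycentric coordinates. The product topology
  agrees with the usual weak topology when the complex is finite, which is the only case
  intended here.\<close>

definition geometric_realization :: "'a set set \<Rightarrow> ('a \<Rightarrow> real) topology" where
  "geometric_realization K = subtopology (powertop_real UNIV)
     {x. (\<forall>v. 0 \<le> x v) \<and> {v. x v \<noteq> 0} \<in> K \<and> (\<Sum>v | x v \<noteq> 0. x v) = 1}"

definition closed_disc :: "nat \<Rightarrow> (nat \<Rightarrow> real) topology" where
  "closed_disc m = subtopology (Euclidean_space m) {x. (\<Sum>i<m. (x i)\<^sup>2) \<le> 1}"

definition open_disc :: "nat \<Rightarrow> (nat \<Rightarrow> real) topology" where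
  "open_disc m = subtopology (Euclidean_space m) {x. (\<Sum>i<m. (x i)\<^sup>2) < 1}"

text \<open>For \<open>m = 0\<close> both discs are a point and the boundary sphere is empty. The sphere is indexed by
  the dimension of the disc it bounds: \<open>disc_boundary (Suc m) = nsphere m\<close>.\<close>

definition disc_boundary :: "nat \<Rightarrow> (nat \<Rightarrow> real) topology" where
  "disc_boundary m = subtopology (Euclidean_space m) {x. (\<Sum>i<m. (x i)\<^sup>2) = 1}"

text \<open>A CW structure on \<open>X\<close> in the sense of Whitehead: a partition \<open>C\<close> of the Hausdorff space \<open>X\<close> into
  open cells, the cell \<open>e\<close> having dimension \<open>dm e\<close>. Every cell has a characteristic map, whose
  attaching part lands in finitely many cells of smaller dimension (closure-finiteness), and the
  topology of \<open>X\<close> is the weak topology determined by the closed cells.\<close>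

definition characteristic_map ::
    "'a topology \<Rightarrow> 'a set set \<Rightarrow> ('a set \<Rightarrow> nat) \<Rightarrow> 'a set \<Rightarrow> ((nat \<Rightarrow> real) \<Rightarrow> 'a) \<Rightarrow> bool" where
  "characteristic_map X C dm e \<Phi> \<longleftrightarrow>
     continuous_map (closed_disc (dm e)) X \<Phi> \<and>
     embedding_map (open_disc (dm e)) X \<Phi> \<and>
     \<Phi> ` topspace (open_disc (dm e)) = e \<and>
     (\<exists>F \<subseteq> C. finite F \<and> (\<forall>f\<in>F. dm f < dm e) \<and> \<Phi> ` topspace (disc_boundary (dm e)) \<subseteq> \<Union>F)"

definition CW_structure :: "'a topology \<Rightarrow> 'a set set \<Rightarrow> ('a set \<Rightarrow> nat) \<Rightarrow> bool" where
  "CW_structure X C dm \<longleftrightarrow>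
     Hausdorff_space X \<and>
     \<Union>C = topspace X \<and> pairwise disjnt C \<and>
     (\<forall>e\<in>C. \<exists>\<Phi>. characteristic_map X C dm e \<Phi>) \<and>
     (\<forall>A \<subseteq> topspace X. (\<forall>e\<in>C. closedin X (A \<inter> X closure_of e)) \<longrightarrow> closedin X A)"

end

theory Submission
  imports Defs
begin

text \<open>A face \<open>F\<close> with at least two points has a smallest element \<open>x\<close>, a largest element \<open>y\<close> and a gap
  \<open>g\<close>, the greatest common divisor of the numbers \<open>f - x\<close> with \<open>f\<close> in \<open>F\<close>. Whether \<open>F\<close> is a face depends
  only on \<open>(x, y, g)\<close>: a progression contains \<open>F\<close> if and only if it contains \<open>x\<close> and \<open>y\<close> and its
  difference divides \<open>g\<close>. Enlarging \<open>F\<close> widens the interval and refines the gap, so the faces with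
  given \<open>(x, y, g)\<close> can be treated separately, from the widest and finest triple downwards.

  Fix the triple and put \<open>l = (y - x) / g\<close>, so that \<open>l \<le> k\<close>. A subset of \<open>{x, x + g, ..., y}\<close>
  containing \<open>x\<close> and \<open>y\<close> has gap exactly \<open>g\<close> if and only if for every prime \<open>p\<close> dividing \<open>l\<close> it has a
  \<^emph>\<open>witness\<close>, a point \<open>f\<close> for which \<open>p * g\<close> does not divide \<open>f - x\<close>. Some point is a witness for \<open>p\<close>
  and for no other prime: \<open>x + g * m\<close>, where \<open>m\<close> is the product of the other primes dividing \<open>l\<close>.
  Adding or deleting that point keeps the triple unless it is the only witness for \<open>p\<close> in \<open>F\<close>. This
  matches all faces with the given triple in pairs, each using the first prime that is possible, except the
  faces in which every prime has its private point as its only witness. The remaining points of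
  such a face are \<open>x\<close> plus multiples of \<open>g * rad l\<close>; so if \<open>l\<close> is not squarefree they can be matched by
  toggling \<open>x + g * rad l\<close>, and if \<open>l\<close> is squarefree there is only one such face, which has one point
  for every prime dividing \<open>l\<close> besides \<open>x\<close> and \<open>y\<close>. Since \<open>l \<le> k\<close> is smaller than the product of the
  first \<open>r\<close> primes, \<open>l\<close> has fewer than \<open>r\<close> prime divisors (\<open>card_less_if_prod_less_primorial\<close>), and
  that face has at most \<open>r + 1\<close> points (\<open>card_le_if_no_active_primes\<close>).

  All pairs whose larger face has at least \<open>r + 2\<close> points are removed by elementary collapses
  (\<open>matching_collapse\<close>, \<open>elementary_collapse_homotopy_equivalent\<close>). A face that properly contains a removed one
  has at least \<open>r + 2\<close> points and is removed as well, so what is left is a subcomplex, and it has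
  dimension at most \<open>r\<close>. Its open simplices are the cells of the required CW structure
  (\<open>CW_structure_geometric_realization\<close>); thus no cells have to be attached abstractly.\<close>

section \<open>Elementary collapses and matchings\<close>

definition realization :: "'a set set \<Rightarrow> ('a \<Rightarrow> real) set" where
  "realization K = {x. (\<forall>v. 0 \<le> x v) \<and> {v. x v \<noteq> 0} \<in> K \<and> (\<Sum>v | x v \<noteq> 0. x v) = 1}"

definition finite_complex :: "'a set set \<Rightarrow> bool" where
  "finite_complex K \<longleftrightarrow> finite K \<and> (\<forall>F\<in>K. finite F) \<and> (\<forall>F\<in>K. \<forall>G\<subseteq>F. G \<in> K)"

lemma geometric_realization_eq_top_of_set: "geometric_realization K = top_of_set (realization K)"
  by (simp add: geometric_realization_def realization_def euclidean_product_topology)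

lemma realizationI:
  assumes "\<And>v. 0 \<le> x v" "{v. x v \<noteq> 0} \<in> K" "{v. x v \<noteq> 0} \<subseteq> S" "finite S" "sum x S = 1"
  shows "x \<in> realization K"
proof -
  have "sum x {v. x v \<noteq> 0} = sum x S"
    using assms(3,4) by (intro sum.mono_neutral_left) auto
  then show ?thesis using assms by (simp add: realization_def)
qed

lemma sum_realization:
  assumes "x \<in> realization K" "{v. x v \<noteq> 0} \<subseteq> S" "finite S"
  shows "sum x S = 1"
proof -
  have "sum x {v. x v \<noteq> 0} = sum x S"
    using assms(2,3) by (intro sum.mono_neutral_left) auto
  then show ?thesis using assms by (simp add: realization_def)
qed

lemma continuous_on_Min:
  fixes f :: "'a \<Rightarrow> 'b::topological_space \<Rightarrow> real"
  assumes "finite A" "A \<noteq> {}" "\<And>a. a \<in> A \<Longrightarrow> continuous_on S (f a)"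
  shows "continuous_on S (\<lambda>x. Min ((\<lambda>a. f a x) ` A))"
  using assms
proof (induction rule: finite_ne_induct)
  case (insert a A)
  then show ?case by (simp add: continuous_on_min)
qed simp

text \<open>The retraction takes the least barycentric coordinate on the free face \<open>\<sigma>\<close> away from every
  vertex of \<open>\<sigma>\<close> and gives the total to the apex \<open>v\<close>. Outside the two removed open simplices that
  minimum is \<open>0\<close>, so nothing moves there; inside them some vertex of \<open>\<sigma>\<close> drops out of the support.
  Moving only a fraction \<open>s\<close> of the mass gives the homotopy.\<close>
lemma elementary_collapse_homotopy_equivalent:
  assumes K: "finite_complex K" and \<tau>: "insert v \<sigma> \<in> K" and ne: "\<sigma> \<noteq> {}" and v: "v \<notin> \<sigma>"
    and free: "\<And>G. G \<in> K \<Longrightarrow> \<sigma> \<subseteq> G \<Longrightarrow> G = \<sigma> \<or> G = insert v \<sigma>"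
  shows "geometric_realization K homotopy_equivalent_space
         geometric_realization (K - {\<sigma>, insert v \<sigma>})"
proof -
  define K' where "K' = K - {\<sigma>, insert v \<sigma>}"
  have fin: "finite \<sigma>" using K \<tau> by (auto simp: finite_complex_def)
  have down: "G \<in> K" if "G \<subseteq> insert v \<sigma>" for G
    using K \<tau> that unfolding finite_complex_def by blast
  define m where "m x = Min ((\<lambda>u. x u) ` \<sigma>)" for x :: "'a \<Rightarrow> real"
  define c where "c u = (if u = v then real (card \<sigma>) else if u \<in> \<sigma> then -1 else 0)" for u
  define h where "h = (\<lambda>(s, x) u. x u + (s * m x) * c u)"
  have sumc: "sum c (insert v \<sigma>) = 0"
  proof -
    have "sum c \<sigma> = (\<Sum>u\<in>\<sigma>. -1)" using v by (intro sum.cong) (auto simp: c_def)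
    then show ?thesis using fin v by (simp add: c_def)
  qed
  have m_le: "m x \<le> x u" if "u \<in> \<sigma>" for x u
    using that fin by (simp add: m_def)
  have m_att: "\<exists>u\<in>\<sigma>. x u = m x" for x
  proof -
    have "m x \<in> x ` \<sigma>" unfolding m_def using fin ne by (intro Min_in) auto
    then show ?thesis by auto
  qed
  have m_ge: "0 \<le> m x" if "x \<in> realization K" for x
    using m_att[of x] that by (auto simp: realization_def) (metis)
  have supp: "{u. h (s, x) u \<noteq> 0} \<subseteq> insert v \<sigma>" if x: "x \<in> realization K" and "m x \<noteq> 0" for s x
  proof -
    have "\<sigma> \<subseteq> {u. x u \<noteq> 0}"
      using m_le[of _ x] m_ge[OF x] that by fastforce
    then have "{u. x u \<noteq> 0} \<subseteq> insert v \<sigma>" using free[of "{u. x u \<noteq> 0}"] x by (auto simp: realization_def)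
    then show ?thesis by (auto simp: h_def c_def split: if_splits)
  qed
  have hK: "h (s, x) \<in> realization K" if x: "x \<in> realization K" and s: "0 \<le> s" "s \<le> 1" for s x
  proof (cases "m x = 0")
    case True
    then show ?thesis using x by (simp add: h_def)
  next
    case False
    have "0 \<le> h (s, x) u" for u
    proof (cases "u \<in> \<sigma>")
      case True
      have "s * m x \<le> 1 * m x" using s m_ge[OF x] by (intro mult_right_mono) auto
      then show ?thesis using m_le[OF True, of x] True v by (auto simp: h_def c_def)
    next
      case False
      then show ?thesis using x s m_ge[OF x] by (auto simp: h_def c_def realization_def)
    qed
    moreover have "sum (h (s, x)) (insert v \<sigma>) = 1"
    proof -
      have "{u. x u \<noteq> 0} \<subseteq> insert v \<sigma>"
        using supp[OF x False, of 0] by (simp add: h_def)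
      then have "sum x (insert v \<sigma>) = 1"
        using x fin by (intro sum_realization) auto
      moreover have "sum (h (s, x)) (insert v \<sigma>) = sum x (insert v \<sigma>) + (s * m x) * sum c (insert v \<sigma>)"
        unfolding h_def prod.case sum.distrib sum_distrib_left ..
      ultimately show ?thesis using sumc by simp
    qed
    ultimately show ?thesis
      using supp[OF x False, of s] down fin by (intro realizationI[where S = "insert v \<sigma>"]) auto
  qed
  have rK': "h (1, x) \<in> realization K'" if x: "x \<in> realization K" for x
  proof -
    obtain u where "u \<in> \<sigma>" "x u = m x" using m_att by blast
    then have "u \<in> \<sigma>" "h (1, x) u = 0" using v by (auto simp: h_def c_def)
    then have "{u. h (1, x) u \<noteq> 0} \<notin> {\<sigma>, insert v \<sigma>}" by blast
    then show ?thesis using hK[OF x, of 1] by (auto simp: realization_def K'_def)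
  qed
  have fixed: "h (1, x) = x" if x: "x \<in> realization K'" for x
  proof -
    have "\<not> \<sigma> \<subseteq> {u. x u \<noteq> 0}" using free[of "{u. x u \<noteq> 0}"] x by (auto simp: realization_def K'_def)
    then obtain u where "u \<in> \<sigma>" "x u = 0" by blast
    moreover have "x \<in> realization K" using x by (auto simp: realization_def K'_def)
    ultimately have "m x = 0" using m_le[of u x] m_ge[of x] by simp
    then show ?thesis by (simp add: h_def)
  qed
  have conth: "continuous_on UNIV h"
  proof -
    have coord: "continuous_on UNIV (\<lambda>p::real \<times> ('a \<Rightarrow> real). snd p u)" for u
      by (rule continuous_on_product_then_coordinatewise) (rule continuous_on_snd[OF continuous_on_id])
    have m: "continuous_on UNIV (\<lambda>p::real \<times> ('a \<Rightarrow> real). m (snd p))"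
      unfolding m_def by (rule continuous_on_Min[OF fin ne coord])
    have "continuous_on UNIV (\<lambda>p. h p u)" for u
      unfolding h_def case_prod_unfold
      by (intro continuous_on_add continuous_on_mult coord m continuous_on_fst continuous_on_id continuous_on_const)
    then show ?thesis by (rule continuous_on_coordinatewise_then_product)
  qed
  have conthX: "continuous_on X h" for X using conth continuous_on_subset by blast
  have contr: "continuous_on X (\<lambda>x. h (1, x))" for X
    by (rule continuous_on_compose2[OF conth])
       (intro continuous_on_Pair continuous_on_const continuous_on_id, simp)
  have sub: "realization K' \<subseteq> realization K" by (auto simp: realization_def K'_def)
  have "homotopic_with (\<lambda>x. True) (top_of_set (realization K)) (top_of_set (realization K)) id (\<lambda>x. h (1, x))"
    unfolding homotopic_with_def
  proof (intro exI[of _ h] conjI)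
    show "continuous_map (prod_topology (top_of_set {0..1}) (top_of_set (realization K))) (top_of_set (realization K)) h"
      using hK by (auto simp: conthX)
    show "\<forall>x. h (0, x) = id x" by (simp add: h_def)
  qed auto
  then have "homotopic_with (\<lambda>x. True) (top_of_set (realization K)) (top_of_set (realization K)) (\<lambda>x. h (1, x)) id"
    by (rule homotopic_with_symD)
  moreover have "retraction_maps (top_of_set (realization K)) (top_of_set (realization K')) (\<lambda>x. h (1, x)) id"
    using sub rK' fixed by (auto simp: retraction_maps_def contr)
  ultimately show ?thesis
    unfolding geometric_realization_eq_top_of_set K'_def[symmetric]
    by (rule deformation_retract_imp_homotopy_equivalent_space)
qed

text \<open>The weight \<open>w\<close> is what makes the matching acyclic: a face and a larger one of the same weight
  are toggled at the same vertex. Take a face \<open>F\<close> of largest cardinality among those of largest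
  weight. It contains its vertex \<open>t F\<close>, and any third face above \<open>F - {t F}\<close>, together with \<open>t F\<close>,
  would be larger than \<open>F\<close> at the same weight; so \<open>F - {t F}\<close> is free and the pair can be collapsed.\<close>
lemma matching_collapse:
  fixes w :: "'a set \<Rightarrow> nat" and t :: "'a set \<Rightarrow> 'a"
  assumes "finite_complex K" and "U \<subseteq> K"
    and up: "\<And>F G. F \<in> U \<Longrightarrow> G \<in> K \<Longrightarrow> F \<subseteq> G \<Longrightarrow> G \<in> U"
    and ins: "\<And>F. F \<in> U \<Longrightarrow> insert (t F) F \<in> U \<and> w (insert (t F) F) = w F \<and> t (insert (t F) F) = t F"
    and del: "\<And>F. F \<in> U \<Longrightarrow> F - {t F} \<in> U \<and> w (F - {t F}) = w F \<and> t (F - {t F}) = t F"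
    and mono: "\<And>F G. F \<in> U \<Longrightarrow> G \<in> U \<Longrightarrow> F \<subseteq> G \<Longrightarrow> w F \<le> w G"
    and same: "\<And>F G. F \<in> U \<Longrightarrow> G \<in> U \<Longrightarrow> F \<subseteq> G \<Longrightarrow> w F = w G \<Longrightarrow> t F = t G"
    and ne: "{} \<notin> U"
  shows "finite_complex (K - U) \<and>
         geometric_realization K homotopy_equivalent_space geometric_realization (K - U)"
  using assms
proof (induction "card U" arbitrary: U K rule: less_induct)
  case (less U K)
  note K = less.prems(1) and UK = less.prems(2) and up = less.prems(3) and ins = less.prems(4)
    and del = less.prems(5) and mono = less.prems(6) and same = less.prems(7) and ne = less.prems(8)
  have finU: "finite U" using K UK by (auto simp: finite_complex_def intro: finite_subset)
  show ?case
  proof (cases "U = {}")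
    case True
    then show ?thesis using K by (simp add: homotopy_equivalent_space_refl)
  next
    case False
    define W where "W = Max (w ` U)"
    have W: "w F \<le> W" if "F \<in> U" for F using finU that by (simp add: W_def)
    define UW where "UW = {F \<in> U. w F = W}"
    have "W \<in> w ` U" unfolding W_def using finU False by (intro Max_in) auto
    then have "UW \<noteq> {}" by (auto simp: UW_def)
    moreover have finUW: "finite UW" using finU by (simp add: UW_def)
    ultimately have "Max (card ` UW) \<in> card ` UW" by simp
    then obtain F where F: "F \<in> UW" "card F = Max (card ` UW)" by auto
    have Fmax: "card G \<le> card F" if "G \<in> UW" for G using that finUW F by simp
    have FU: "F \<in> U" "w F = W" using F by (auto simp: UW_def)
    have fin: "finite G" if "G \<in> U" for G using that K UK by (auto simp: finite_complex_def)
    have tF: "t F \<in> F"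
    proof (rule ccontr)
      assume "t F \<notin> F"
      then have "card (insert (t F) F) = Suc (card F)" using fin[OF FU(1)] by simp
      then show False using Fmax[of "insert (t F) F"] ins[OF FU(1)] FU(2) by (simp add: UW_def)
    qed
    define \<sigma> where "\<sigma> = F - {t F}"
    have \<sigma>: "\<sigma> \<in> U" "w \<sigma> = W" "t \<sigma> = t F" "t F \<notin> \<sigma>" "insert (t F) \<sigma> = F"
      using del[OF FU(1)] FU tF by (auto simp: \<sigma>_def)
    have free: "G = \<sigma> \<or> G = F" if G: "G \<in> K" "\<sigma> \<subseteq> G" for G
    proof (rule ccontr)
      assume neq: "\<not> (G = \<sigma> \<or> G = F)"
      have GU: "G \<in> U" using up \<sigma>(1) G by blast
      have wG: "w G = W" using mono[OF \<sigma>(1) GU G(2)] W[OF GU] \<sigma>(2) by simp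
      have tG: "t G = t F" using same[OF \<sigma>(1) GU G(2)] wG \<sigma>(2,3) by simp
      have "card (insert (t F) G) \<le> card F"
        using Fmax[of "insert (t F) G"] ins[OF GU] wG tG by (simp add: UW_def)
      moreover have "F \<subseteq> insert (t F) G" using G(2) \<sigma>(5) by blast
      ultimately have "F = insert (t F) G" using fin[OF GU] by (intro card_seteq) auto
      then show False using neq G(2) \<sigma>(5) tF unfolding \<sigma>_def by blast
    qed
    define K' U' where "K' = K - {\<sigma>, F}" and "U' = U - {\<sigma>, F}"
    have hom: "geometric_realization K homotopy_equivalent_space geometric_realization K'"
    proof -
      have "insert (t F) \<sigma> \<in> K" using FU(1) UK unfolding \<sigma>(5) by blast
      moreover have "\<sigma> \<noteq> {}" using \<sigma>(1) ne by blast
      moreover have "G = \<sigma> \<or> G = insert (t F) \<sigma>" if "G \<in> K" "\<sigma> \<subseteq> G" for G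
        unfolding \<sigma>(5) using free that by blast
      ultimately have "geometric_realization K homotopy_equivalent_space
          geometric_realization (K - {\<sigma>, insert (t F) \<sigma>})"
        using \<sigma>(4) by (intro elementary_collapse_homotopy_equivalent[OF K])
      then show ?thesis unfolding \<sigma>(5) K'_def .
    qed
    have K': "finite_complex K'"
    proof -
      have "G \<in> K'" if "H \<in> K'" "G \<subseteq> H" for G H
      proof -
        have H: "H \<in> K" "H \<noteq> \<sigma>" "H \<noteq> F" using that(1) by (auto simp: K'_def)
        then have "\<not> \<sigma> \<subseteq> H" using free by blast
        then have "\<not> \<sigma> \<subseteq> G" using that(2) by blast
        then have "G \<noteq> \<sigma>" "G \<noteq> F" by (auto simp: \<sigma>_def)
        moreover have "G \<in> K" using H(1) that(2) K unfolding finite_complex_def by blast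
        ultimately show ?thesis by (simp add: K'_def)
      qed
      moreover have "finite K'" "\<forall>G\<in>K'. finite G" using K by (auto simp: finite_complex_def K'_def)
      ultimately show ?thesis unfolding finite_complex_def by blast
    qed
    \<comment> \<open>The pair removed is a full orbit of the toggle, so the toggle still acts on what remains.\<close>
    have tog: "G \<in> U'" if "G \<in> U" "H \<in> U'" "t G = t H" "G - {t G} = H - {t G}" for G H
    proof -
      have "G \<noteq> F \<and> G \<noteq> \<sigma>"
      proof (rule ccontr)
        assume "\<not> (G \<noteq> F \<and> G \<noteq> \<sigma>)"
        then have "t G = t F" "H - {t F} = \<sigma>" using \<sigma> that(4) unfolding \<sigma>_def by auto
        then have "H = \<sigma> \<or> H = F" using insert_Diff[of "t F" H] \<sigma>(5) by (cases "t F \<in> H") simp_all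
        then show False using that(2) by (auto simp: U'_def)
      qed
      then show ?thesis using that(1) by (simp add: U'_def)
    qed
    have "card U' < card U"
      using finU \<sigma>(1) unfolding U'_def by (intro psubset_card_mono) auto
    then have "finite_complex (K' - U') \<and>
        geometric_realization K' homotopy_equivalent_space geometric_realization (K' - U')"
    proof (rule less.hyps[OF _ K'])
      show "U' \<subseteq> K'" using UK by (auto simp: U'_def K'_def)
      show "G \<in> U'" if "H \<in> U'" "G \<in> K'" "H \<subseteq> G" for G H
        using up[of H G] that by (auto simp: U'_def K'_def)
      show "insert (t G) G \<in> U' \<and> w (insert (t G) G) = w G \<and> t (insert (t G) G) = t G" if "G \<in> U'" for G
        using ins[of G] that tog[of "insert (t G) G" G] by (auto simp: U'_def)
      show "G - {t G} \<in> U' \<and> w (G - {t G}) = w G \<and> t (G - {t G}) = t G" if "G \<in> U'" for G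
        using del[of G] that tog[of "G - {t G}" G] by (auto simp: U'_def)
    qed (use mono same ne in \<open>auto simp: U'_def\<close>)
    moreover have "K' - U' = K - U" using FU \<sigma> by (auto simp: K'_def U'_def)
    ultimately show ?thesis using hom by (metis homotopy_eqv_trans)
  qed
qed

section \<open>The simplices of a finite complex as cells\<close>

definition open_simplex :: "'a set \<Rightarrow> ('a \<Rightarrow> real) set" where
  "open_simplex \<sigma> = {x. (\<forall>v. 0 \<le> x v) \<and> {v. x v \<noteq> 0} = \<sigma> \<and> sum x \<sigma> = 1}"

lemma sum_sq_eq_0:
  fixes x :: "nat \<Rightarrow> real"
  assumes "(\<Sum>i<m. (x i)\<^sup>2) \<noteq> 0" shows "\<exists>i<m. x i \<noteq> 0"
  using assms by (metis (mono_tags, lifting) lessThan_iff power_zero_numeral sum.neutral)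

text \<open>Let \<open>w\<close> be the linear isomorphism from \<open>m\<close>-space onto the hyperplane of vectors with
  coordinate sum \<open>0\<close>, let \<open>M = m + 1\<close>, and let \<open>N\<close> be the gauge for which \<open>N \<le> 1\<close> describes the simplex with its
  barycentre \<open>b = (1 / M, ..., 1 / M)\<close> moved to the origin. The radial homeomorphism \<open>b + (\<bar>x\<bar> / N x) w x\<close>
  would need an argument at the origin; the map \<open>b + w x / (N x + 1 - \<bar>x\<bar>\<^sup>2)\<close> has the same boundary
  values, is visibly continuous because its denominator is positive on the disc, and is still
  strictly increasing along rays.\<close>
lemma disc_to_simplex:
  fixes \<sigma> :: "'a set"
  assumes fin: "finite \<sigma>" and card: "card \<sigma> = Suc m"
  obtains \<Phi> :: "(nat \<Rightarrow> real) \<Rightarrow> 'a \<Rightarrow> real" where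
    "continuous_on (topspace (closed_disc m)) \<Phi>"
    "inj_on \<Phi> (topspace (closed_disc m))"
    "\<Phi> ` topspace (open_disc m) = open_simplex \<sigma>"
    "\<Phi> ` topspace (disc_boundary m) \<subseteq> \<Union> (open_simplex ` {\<rho>. \<rho> \<subset> \<sigma> \<and> \<rho> \<noteq> {}})"
proof -
  have "\<exists>g. bij_betw g \<sigma> {..m}"
    using fin card by (intro finite_same_card_bij) auto
  then obtain idx where idx: "bij_betw idx \<sigma> {..m}" ..
  define f where "f = inv_into \<sigma> idx"
  have f: "f i \<in> \<sigma>" "idx (f i) = i" if "i \<le> m" for i
    using idx that unfolding f_def
    by (auto simp: bij_betw_def inv_into_into f_inv_into_f)
  have idx_le: "idx u \<le> m" if "u \<in> \<sigma>" for u using idx that by (auto simp: bij_betw_def)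
  have f_idx: "f (idx u) = u" if "u \<in> \<sigma>" for u
    using idx that unfolding f_def by (auto simp: bij_betw_def)
  define M where "M = real (Suc m)"
  have M: "0 < M" by (simp add: M_def)
  define w where "w x i = (if i < m then x i else - (\<Sum>j<m. x j))" for x :: "nat \<Rightarrow> real" and i
  define N where "N x = - (M * Min ((\<lambda>i. w x i) ` {..m}))" for x
  define q where "q x = (\<Sum>i<m. (x i)\<^sup>2)" for x :: "nat \<Rightarrow> real"
  define A where "A x = N x + 1 - q x" for x
  define \<Phi> where "\<Phi> x u = (if u \<in> \<sigma> then 1 / M + w x (idx u) / A x else 0)" for x u
  have sum_w: "(\<Sum>i\<le>m. w x i) = 0" for x
  proof -
    have "(\<Sum>i<m. w x i) = (\<Sum>i<m. x i)" by (intro sum.cong) (auto simp: w_def)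
    then have "sum (w x) (insert m {..<m}) = 0" by (simp add: w_def)
    moreover have "insert m {..<m} = {..m}" by auto
    ultimately show ?thesis by simp
  qed
  have w_scale: "w (\<lambda>i. c * x i) i = c * w x i" for c x i
    by (simp add: w_def sum_distrib_left)
  have q_scale: "q (\<lambda>i. c * x i) = c\<^sup>2 * q x" for c x
    by (simp add: q_def sum_distrib_left power_mult_distrib)
  have le_N: "- (M * w x i) \<le> N x" if "i \<le> m" for x i
  proof -
    have "Min ((\<lambda>i. w x i) ` {..m}) \<le> w x i" using that by (intro Min_le) auto
    then show ?thesis unfolding N_def using M by (simp add: mult_left_mono)
  qed
  have N_att: "\<exists>i\<le>m. N x = - (M * w x i)" for x
  proof -
    have "Min ((\<lambda>i. w x i) ` {..m}) \<in> (\<lambda>i. w x i) ` {..m}" by (intro Min_in) auto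
    then obtain i where "i \<le> m" "Min ((\<lambda>i. w x i) ` {..m}) = w x i"
      by (metis (no_types, lifting) atMost_iff imageE)
    then have "N x = - (M * w x i)" by (simp add: N_def)
    then show ?thesis using \<open>i \<le> m\<close> by blast
  qed
  have N_scale: "N (\<lambda>i. c * x i) = c * N x" if "0 < c" for c x
  proof (rule antisym)
    obtain i where i: "i \<le> m" "N (\<lambda>i. c * x i) = - (M * w (\<lambda>i. c * x i) i)" using N_att by blast
    then have "N (\<lambda>i. c * x i) = c * (- (M * w x i))" by (simp add: w_scale)
    then show "N (\<lambda>i. c * x i) \<le> c * N x" using mult_left_mono[OF le_N[OF i(1), of x], of c] that by simp
    obtain i where i: "i \<le> m" "N x = - (M * w x i)" using N_att by blast
    then have "c * N x = - (M * w (\<lambda>i. c * x i) i)" by (simp add: w_scale)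
    then show "c * N x \<le> N (\<lambda>i. c * x i)" using le_N[OF i(1), of "\<lambda>i. c * x i"] by simp
  qed
  have N_ge: "0 \<le> N x" for x
  proof (rule ccontr)
    assume "\<not> 0 \<le> N x"
    then have "0 < w x i" if "i \<le> m" for i
      using le_N[OF that, of x] M by (smt (verit) mult_nonneg_nonpos)
    then have "0 < (\<Sum>i\<le>m. w x i)" by (intro sum_pos) auto
    then show False by (simp add: sum_w)
  qed
  have N_pos: "0 < N x" if "q x \<noteq> 0" for x
  proof (rule ccontr)
    assume "\<not> 0 < N x"
    then have "0 \<le> w x i" if "i \<le> m" for i
      using le_N[OF that, of x] M by (smt (verit) mult_pos_neg)
    then have "\<forall>i\<in>{..m}. w x i = 0" using sum_w[of x] by (subst (asm) sum_nonneg_eq_0_iff) auto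
    then have "\<forall>i<m. x i = 0" by (metis atMost_iff less_imp_le w_def)
    then show False using that sum_sq_eq_0[of x m] by (auto simp: q_def)
  qed
  have q_ge: "0 \<le> q x" for x by (simp add: q_def sum_nonneg)
  have A_pos: "0 < A x" if "q x \<le> 1" for x
    using N_ge[of x] N_pos[of x] that by (cases "q x = 0") (auto simp: A_def)
  have sum_\<Phi>: "sum (\<Phi> x) \<sigma> = 1" for x
  proof -
    have "sum (\<Phi> x) \<sigma> = (\<Sum>u\<in>\<sigma>. 1 / M + w x (idx u) / A x)"
      by (intro sum.cong) (auto simp: \<Phi>_def)
    also have "\<dots> = (\<Sum>i\<le>m. 1 / M + w x i / A x)"
      by (rule sum.reindex_bij_betw[OF idx])
    also have "\<dots> = 1 + (\<Sum>i\<le>m. w x i) / A x"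
      by (simp add: sum.distrib sum_divide_distrib M_def)
    finally show ?thesis by (simp add: sum_w)
  qed
  have \<Phi>_alt: "\<Phi> x u = (A x + M * w x (idx u)) / (M * A x)" if "u \<in> \<sigma>" "q x \<le> 1" for x u
    using that A_pos[of x] M by (simp add: \<Phi>_def divide_simps)
  have \<Phi>_ge: "0 \<le> \<Phi> x u" if "q x \<le> 1" for x u
  proof (cases "u \<in> \<sigma>")
    case True
    have "0 \<le> A x + M * w x (idx u)" using le_N[OF idx_le[OF True], of x] that by (simp add: A_def)
    then show ?thesis using A_pos[OF that] M by (simp add: \<Phi>_alt[OF True that])
  qed (simp add: \<Phi>_def)
  have \<Phi>_pos: "0 < \<Phi> x u" if "q x < 1" "u \<in> \<sigma>" for x u
  proof -
    have "0 < A x + M * w x (idx u)" using le_N[OF idx_le[OF that(2)], of x] that(1) by (simp add: A_def)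
    then show ?thesis using A_pos[of x] M that by (simp add: \<Phi>_alt)
  qed
  have "continuous_on (topspace (closed_disc m)) \<Phi>"
  proof (rule continuous_on_coordinatewise_then_product)
    have x: "continuous_on X (\<lambda>x. x i)" for X and i :: nat
      by (rule continuous_on_product_then_coordinatewise[OF continuous_on_id])
    have w: "continuous_on X (\<lambda>x. w x i)" for X i
      unfolding w_def by (cases "i < m") (auto intro!: continuous_on_minus continuous_on_sum x)
    have N: "continuous_on X N" for X
      unfolding N_def by (intro continuous_on_minus continuous_on_mult continuous_on_const continuous_on_Min w) auto
    have q: "continuous_on X q" for X
      unfolding q_def by (intro continuous_on_sum continuous_on_power x)
    have A: "continuous_on X A" for X
      unfolding A_def by (intro continuous_intros N q)
    have "\<forall>x\<in>topspace (closed_disc m). A x \<noteq> 0"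
      using A_pos by (force simp: closed_disc_def topspace_Euclidean_space q_def)
    then show "continuous_on (topspace (closed_disc m)) (\<lambda>x. \<Phi> x u)" for u
      unfolding \<Phi>_def by (cases "u \<in> \<sigma>") (auto intro!: continuous_intros A w)
  qed
  moreover have "inj_on \<Phi> (topspace (closed_disc m))"
  proof (rule inj_onI)
    fix x y assume "x \<in> topspace (closed_disc m)" "y \<in> topspace (closed_disc m)" and eq: "\<Phi> x = \<Phi> y"
    then have x: "q x \<le> 1" "\<And>i. m \<le> i \<Longrightarrow> x i = 0" and y: "q y \<le> 1" "\<And>i. m \<le> i \<Longrightarrow> y i = 0"
      by (auto simp: closed_disc_def topspace_Euclidean_space q_def)
    define c where "c = A y / A x"
    have c: "0 < c" "A y = c * A x" using A_pos[OF x(1)] A_pos[OF y(1)] by (auto simp: c_def)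
    have "y i = c * x i" for i
    proof (cases "i < m")
      case True
      have "\<Phi> x (f i) = \<Phi> y (f i)" using eq by simp
      then have "x i / A x = y i / A y" using True f[of i] by (simp add: \<Phi>_def w_def)
      then show ?thesis using A_pos[OF x(1)] A_pos[OF y(1)] by (simp add: c_def field_simps)
    qed (use x y in auto)
    then have y_eq: "y = (\<lambda>i. c * x i)" by auto
    \<comment> \<open>Equal images lie on one ray; comparing denominators leaves only \<open>c = 1\<close>.\<close>
    have "c * A x = c * N x + 1 - c\<^sup>2 * q x"
      using c A_def[of y] unfolding y_eq N_scale[OF c(1)] q_scale by simp
    then have "(1 - c) * (1 + c * q x) = 0"
      by (simp add: A_def algebra_simps power2_eq_square)
    moreover have "0 < 1 + c * q x" using c q_ge[of x] by (simp add: add_pos_nonneg)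
    ultimately have "c = 1" by simp
    then show "x = y" using y_eq by simp
  qed
  moreover have "\<Phi> ` topspace (open_disc m) = open_simplex \<sigma>"
  proof (intro equalityI subsetI)
    fix t assume "t \<in> \<Phi> ` topspace (open_disc m)"
    then obtain x where t: "t = \<Phi> x" and x: "q x < 1"
      by (auto simp: open_disc_def q_def)
    have "{v. \<Phi> x v \<noteq> 0} = \<sigma>"
      using \<Phi>_pos[OF x] by (force simp: \<Phi>_def)
    then show "t \<in> open_simplex \<sigma>" using \<Phi>_ge[of x] x sum_\<Phi>[of x] by (simp add: open_simplex_def t)
  next
    fix t assume t: "t \<in> open_simplex \<sigma>"
    define u where "u i = t (f i) - 1 / M" for i
    define x0 where "x0 i = (if i < m then u i else 0)" for i
    have "(\<Sum>i\<le>m. t (f i)) = (\<Sum>v\<in>\<sigma>. t (f (idx v)))"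
      using sum.reindex_bij_betw[OF idx, of "\<lambda>i. t (f i)"] by simp
    also have "\<dots> = 1" using f_idx t by (simp add: open_simplex_def)
    finally have "(\<Sum>i\<le>m. u i) = 0" using M by (simp add: u_def sum_subtractf M_def)
    moreover have "{..m} = insert m {..<m}" by auto
    ultimately have um: "u m = - (\<Sum>i<m. u i)" by simp
    have w0: "w x0 i = u i" if "i \<le> m" for i
      using that um by (auto simp: w_def x0_def)
    have tpos: "0 < t v" if "v \<in> \<sigma>" for v
    proof -
      have "0 \<le> t v" "t v \<noteq> 0" using t that by (auto simp: open_simplex_def)
      then show ?thesis by simp
    qed
    obtain i where i: "i \<le> m" "N x0 = - (M * w x0 i)" using N_att by blast
    then have "N x0 = 1 - M * t (f i)" using M by (simp add: w0 u_def algebra_simps)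
    then have N0: "N x0 < 1" using tpos[OF f(1)[OF i(1)]] M by simp
    \<comment> \<open>A multiple \<open>s * x0\<close> is mapped to \<open>t\<close> as soon as \<open>A (s * x0) = s\<close>, that is, \<open>q x0 * s\<^sup>2 + a * s = 1\<close>. This
      form of the positive root is also correct when \<open>q x0 = 0\<close>.\<close>
    define a where "a = 1 - N x0"
    define s where "s = 2 / (a + sqrt (a\<^sup>2 + 4 * q x0))"
    have a: "0 < a" using N0 by (simp add: a_def)
    have sq: "(sqrt (a\<^sup>2 + 4 * q x0))\<^sup>2 = a\<^sup>2 + 4 * q x0" using q_ge[of x0] by simp
    have den: "0 < a + sqrt (a\<^sup>2 + 4 * q x0)" using a q_ge[of x0] by (simp add: add_pos_nonneg)
    have s: "0 < s" using den by (simp add: s_def)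
    have s_eq: "q x0 * s\<^sup>2 + a * s = 1"
    proof -
      define b where "b = sqrt (a\<^sup>2 + 4 * q x0)"
      have "4 * q x0 = (b - a) * (b + a)" using sq by (simp add: b_def algebra_simps power2_eq_square)
      moreover have "0 < a + b" using den by (simp add: b_def)
      then have "(a + b) * s = 2" unfolding s_def b_def[symmetric] by (metis less_irrefl nonzero_mult_div_cancel_left times_divide_eq_right)
      ultimately have "4 * (q x0 * s\<^sup>2 + a * s) = (b - a) * s * 2 + 4 * a * s"
        by (simp add: power2_eq_square) algebra
      also have "\<dots> = 2 * ((a + b) * s)" by (simp add: algebra_simps)
      also have "\<dots> = 4" using \<open>(a + b) * s = 2\<close> by simp
      finally show ?thesis by simp
    qed
    define x where "x = (\<lambda>i. s * x0 i)"
    have qx: "q x = 1 - a * s" using s_eq by (simp add: x_def q_scale mult.commute)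
    then have "q x < 1" using a s by simp
    moreover have "x i = 0" if "m \<le> i" for i using that by (simp add: x_def x0_def)
    ultimately have "x \<in> topspace (open_disc m)"
      by (simp add: open_disc_def topspace_Euclidean_space q_def)
    moreover have "\<Phi> x = t"
    proof
      fix v
      have Ax: "A x = s"
        using qx N_scale[OF s, of x0] by (simp add: A_def x_def[symmetric] a_def algebra_simps)
      show "\<Phi> x v = t v"
      proof (cases "v \<in> \<sigma>")
        case True
        have "w x (idx v) = s * u (idx v)" using w0[OF idx_le[OF True]] by (simp add: x_def w_scale)
        then have "\<Phi> x v = 1 / M + u (idx v)" using True s by (simp add: \<Phi>_def Ax)
        then show ?thesis using f_idx[OF True] by (simp add: u_def)
      qed (use t in \<open>auto simp: \<Phi>_def open_simplex_def\<close>)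
    qed
    ultimately show "t \<in> \<Phi> ` topspace (open_disc m)" by blast
  qed
  moreover have "\<Phi> ` topspace (disc_boundary m) \<subseteq> \<Union> (open_simplex ` {\<rho>. \<rho> \<subset> \<sigma> \<and> \<rho> \<noteq> {}})"
  proof
    fix t assume "t \<in> \<Phi> ` topspace (disc_boundary m)"
    then obtain x where t: "t = \<Phi> x" and x: "q x = 1"
      by (auto simp: disc_boundary_def q_def)
    define \<rho> where "\<rho> = {v. \<Phi> x v \<noteq> 0}"
    have sub: "\<rho> \<subseteq> \<sigma>" by (auto simp: \<rho>_def \<Phi>_def)
    obtain i where i: "i \<le> m" "N x = - (M * w x i)" using N_att by blast
    then have "\<Phi> x (f i) = 0" using x f[OF i(1)] by (simp add: \<Phi>_alt A_def)
    then have "\<rho> \<noteq> \<sigma>" using f[OF i(1)] by (auto simp: \<rho>_def)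
    moreover have "sum (\<Phi> x) \<rho> = sum (\<Phi> x) \<sigma>"
      using fin sub by (intro sum.mono_neutral_left) (auto simp: \<rho>_def)
    then have "sum (\<Phi> x) \<rho> = 1" using sum_\<Phi> by simp
    moreover from this have "\<rho> \<noteq> {}" by auto
    ultimately have "\<rho> \<subset> \<sigma>" "\<rho> \<noteq> {}" "t \<in> open_simplex \<rho>"
      using sub \<Phi>_ge[of x] x by (auto simp: t open_simplex_def \<rho>_def)
    then show "t \<in> \<Union> (open_simplex ` {\<rho>. \<rho> \<subset> \<sigma> \<and> \<rho> \<noteq> {}})" by blast
  qed
  ultimately show thesis by (rule that)
qed

lemma Hausdorff_space_geometric_realization: "Hausdorff_space (geometric_realization K)"
  unfolding geometric_realization_def
  by (intro Hausdorff_space_subtopology) (simp add: Hausdorff_space_product_topology)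

lemma compact_space_closed_disc: "compact_space (closed_disc m)"
proof -
  have sum: "compactin (powertop_real UNIV) (PiE UNIV (\<lambda>i. {-1..1::real}))"
    by (simp add: compactin_PiE)
  have coord: "continuous_map (powertop_real UNIV) euclideanreal (\<lambda>x. x i)" for i :: nat
    using continuous_map_product_coordinates[of i UNIV "\<lambda>_. euclideanreal"] by simp
  have "continuous_map (powertop_real UNIV) euclideanreal (\<lambda>x::nat \<Rightarrow> real. \<Sum>i<m. (x i)\<^sup>2)"
    by (intro continuous_map_sum continuous_map_real_pow coord) auto
  then have "closedin (powertop_real UNIV) {x \<in> topspace (powertop_real UNIV). (\<Sum>i<m. (x i)\<^sup>2) \<in> {..1::real}}"
    by (rule closedin_continuous_map_preimage) simp
  moreover define D :: "(nat \<Rightarrow> real) set" where "D = {x. (\<forall>i\<ge>m. x i = 0) \<and> (\<Sum>i<m. (x i)\<^sup>2) \<le> 1}"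
  have "D = topspace (Euclidean_space m) \<inter> {x \<in> topspace (powertop_real UNIV). (\<Sum>i<m. (x i)\<^sup>2) \<in> {..1::real}}"
    by (auto simp: D_def topspace_Euclidean_space)
  ultimately have clo: "closedin (powertop_real UNIV) D"
    using closedin_Euclidean_space by (simp add: closedin_Int)
  have "-1 \<le> x i \<and> x i \<le> 1" if "x \<in> D" for x i
  proof (cases "i < m")
    case True
    then have "(x i)\<^sup>2 \<le> (\<Sum>i<m. (x i)\<^sup>2)" by (intro member_le_sum) auto
    then have "(x i)\<^sup>2 \<le> 1" using that by (simp add: D_def)
    then show ?thesis by (simp add: abs_square_le_1 abs_le_iff)
  qed (use that in \<open>simp add: D_def\<close>)
  then have "D \<subseteq> PiE UNIV (\<lambda>i. {-1..1::real})" by auto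
  then have "compactin (powertop_real UNIV) D" by (rule closed_compactin[OF sum _ clo])
  moreover have "closed_disc m = subtopology (powertop_real UNIV) D"
    by (simp add: closed_disc_def Euclidean_space_def subtopology_subtopology D_def Collect_conj_eq[symmetric])
  ultimately show ?thesis by (simp add: compact_space_subtopology)
qed

lemma realization_eq_Union_open_simplices:
  "realization K = \<Union> (open_simplex ` (K - {{}}))"
proof (intro equalityI subsetI)
  fix x assume x: "x \<in> realization K"
  then have "{v. x v \<noteq> 0} \<noteq> {}" unfolding realization_def by (metis (mono_tags, lifting) mem_Collect_eq sum.empty zero_neq_one)
  then show "x \<in> \<Union> (open_simplex ` (K - {{}}))" using x by (auto simp: realization_def open_simplex_def)
qed (auto simp: realization_def open_simplex_def)

lemma open_simplex_nonempty:
  assumes "finite \<sigma>" "\<sigma> \<noteq> {}"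
  shows "open_simplex \<sigma> \<noteq> {}"
proof -
  have "(\<lambda>v. if v \<in> \<sigma> then 1 / real (card \<sigma>) else 0) \<in> open_simplex \<sigma>"
    using assms by (auto simp: open_simplex_def)
  then show ?thesis by blast
qed

text \<open>A cell is a bare set of points, so its dimension is read off from the vertices on which some
  of its points are supported.\<close>
definition simplex_dim :: "('a \<Rightarrow> real) set \<Rightarrow> nat" where
  "simplex_dim e = card (\<Union>x\<in>e. {v. x v \<noteq> 0}) - 1"

lemma simplex_dim_open_simplex:
  assumes "finite \<sigma>" "\<sigma> \<noteq> {}"
  shows "simplex_dim (open_simplex \<sigma>) = card \<sigma> - 1"
proof -
  have "(\<Union>x\<in>open_simplex \<sigma>. {v. x v \<noteq> 0}) = (\<Union>x\<in>open_simplex \<sigma>. \<sigma>)"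
    by (intro SUP_cong) (auto simp: open_simplex_def)
  then show ?thesis using open_simplex_nonempty[OF assms] by (simp add: simplex_dim_def)
qed

lemma characteristic_map_open_simplex:
  assumes K: "finite_complex K" and \<sigma>: "\<sigma> \<in> K" "\<sigma> \<noteq> {}"
  shows "\<exists>\<Phi>. characteristic_map (geometric_realization K) (open_simplex ` (K - {{}})) simplex_dim (open_simplex \<sigma>) \<Phi>"
proof -
  have fin: "finite \<sigma>" using K \<sigma> by (simp add: finite_complex_def)
  define m where "m = card \<sigma> - 1"
  have card: "card \<sigma> = Suc m" using fin \<sigma>(2) by (simp add: m_def card_gt_0_iff)
  have dim: "simplex_dim (open_simplex \<sigma>) = m" using simplex_dim_open_simplex[OF fin \<sigma>(2)] by (simp add: m_def)
  obtain \<Phi> :: "(nat \<Rightarrow> real) \<Rightarrow> 'a \<Rightarrow> real" where cont: "continuous_on (topspace (closed_disc m)) \<Phi>"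
    and inj: "inj_on \<Phi> (topspace (closed_disc m))"
    and int: "\<Phi> ` topspace (open_disc m) = open_simplex \<sigma>"
    and bd: "\<Phi> ` topspace (disc_boundary m) \<subseteq> \<Union> (open_simplex ` {\<rho>. \<rho> \<subset> \<sigma> \<and> \<rho> \<noteq> {}})"
    using disc_to_simplex[OF fin card] .
  let ?F = "open_simplex ` {\<rho>. \<rho> \<subset> \<sigma> \<and> \<rho> \<noteq> {}}"
  have cell: "?F \<subseteq> open_simplex ` (K - {{}})"
    using K \<sigma>(1) by (auto simp: finite_complex_def)
  have disc_eq: "topspace (closed_disc m) = topspace (open_disc m) \<union> topspace (disc_boundary m)"
    by (auto simp: closed_disc_def open_disc_def disc_boundary_def)
  have range: "\<Phi> ` topspace (closed_disc m) \<subseteq> realization K"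
    using int bd cell \<sigma> realization_eq_Union_open_simplices[of K] unfolding disc_eq by blast
  have "closed_disc m = top_of_set (topspace (closed_disc m))"
    by (simp add: closed_disc_def Euclidean_space_def subtopology_subtopology euclidean_product_topology)
  then have cm: "continuous_map (closed_disc m) (geometric_realization K) \<Phi>"
    unfolding geometric_realization_eq_top_of_set using cont range
    by (metis continuous_map_subtopology_eu image_subset_iff_funcset)
  have "embedding_map (closed_disc m) (geometric_realization K) \<Phi>"
    using cm compact_space_closed_disc Hausdorff_space_geometric_realization inj
    by (rule continuous_imp_embedding_map)
  then have hom: "homeomorphic_map (closed_disc m)
      (subtopology (geometric_realization K) (\<Phi> ` topspace (closed_disc m))) \<Phi>"
    by (simp add: embedding_map_def)
  have "\<Phi> ` (topspace (closed_disc m) \<inter> topspace (open_disc m)) =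
      topspace (subtopology (geometric_realization K) (\<Phi> ` topspace (closed_disc m))) \<inter> \<Phi> ` topspace (open_disc m)"
    using range disc_eq by (auto simp: geometric_realization_eq_top_of_set)
  from homeomorphic_map_subtopologies[OF hom this]
  have "homeomorphic_map (subtopology (closed_disc m) (topspace (open_disc m)))
      (subtopology (geometric_realization K) (\<Phi> ` topspace (open_disc m))) \<Phi>"
    unfolding subtopology_subtopology disc_eq image_Un by (simp add: Int_absorb1)
  moreover have "subtopology (closed_disc m) (topspace (open_disc m)) = open_disc m"
    by (auto simp: closed_disc_def open_disc_def Euclidean_space_def subtopology_subtopology
        intro!: arg_cong[where f = "subtopology (powertop_real UNIV)"])
  ultimately have emb: "embedding_map (open_disc m) (geometric_realization K) \<Phi>"
    by (simp add: embedding_map_def)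
  have "\<forall>f\<in>?F. simplex_dim f < m"
  proof
    fix f assume "f \<in> ?F"
    then obtain \<rho> where \<rho>: "\<rho> \<subset> \<sigma>" "\<rho> \<noteq> {}" "f = open_simplex \<rho>" by auto
    then have "finite \<rho>" "card \<rho> < card \<sigma>" using fin by (auto intro: finite_subset psubset_card_mono)
    moreover have "0 < card \<rho>" using \<open>finite \<rho>\<close> \<rho>(2) by (simp add: card_gt_0_iff)
    ultimately show "simplex_dim f < m" using \<rho> card by (simp add: simplex_dim_open_simplex)
  qed
  moreover have "finite ?F" using fin by (intro finite_imageI) (auto intro: finite_subset[of _ "Pow \<sigma>"])
  ultimately show ?thesis
    unfolding characteristic_map_def dim using cm emb int bd cell by blast
qed

text \<open>There are finitely many cells, so a set whose traces on the closed cells are closed is a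
  finite union of closed sets.\<close>
theorem CW_structure_geometric_realization:
  assumes K: "finite_complex K"
  shows "CW_structure (geometric_realization K) (open_simplex ` (K - {{}})) simplex_dim"
  unfolding CW_structure_def
proof (intro conjI allI impI)
  let ?C = "open_simplex ` (K - {{}})"
  show "Hausdorff_space (geometric_realization K)" by (rule Hausdorff_space_geometric_realization)
  show cover: "\<Union>?C = topspace (geometric_realization K)"
    using realization_eq_Union_open_simplices[of K] by (simp add: geometric_realization_eq_top_of_set)
  show "pairwise disjnt ?C"
    by (auto simp: pairwise_def disjnt_def open_simplex_def)
  show "\<forall>e\<in>?C. \<exists>\<Phi>. characteristic_map (geometric_realization K) ?C simplex_dim e \<Phi>"
    using characteristic_map_open_simplex[OF K] by blast
  fix A assume A: "A \<subseteq> topspace (geometric_realization K)"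
    and closed: "\<forall>e\<in>?C. closedin (geometric_realization K) (A \<inter> geometric_realization K closure_of e)"
  have "finite ?C" using K by (simp add: finite_complex_def)
  then have "closedin (geometric_realization K) (\<Union>e\<in>?C. A \<inter> geometric_realization K closure_of e)"
    using closed by (intro closedin_Union) auto
  moreover have "(\<Union>e\<in>?C. A \<inter> geometric_realization K closure_of e) = A"
  proof -
    have "\<exists>e\<in>?C. x \<in> geometric_realization K closure_of e" if "x \<in> A" for x
    proof -
      have "x \<in> \<Union>?C" unfolding cover using A that by (rule subsetD)
      then obtain e where e: "e \<in> ?C" "x \<in> e" by (rule UnionE)
      have "e \<subseteq> topspace (geometric_realization K)" unfolding cover[symmetric] using e(1) by (rule Union_upper)
      then have "x \<in> geometric_realization K closure_of e" using e(2) by (rule subsetD[OF closure_of_subset])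
      then show ?thesis using e(1) by (rule bexI)
    qed
    then show ?thesis unfolding Int_UN_distrib[symmetric] by (intro Int_absorb2 subsetI) simp
  qed
  ultimately show "closedin (geometric_realization K) A" by simp
qed

section \<open>Numbers with few prime divisors\<close>

definition rad :: "nat \<Rightarrow> nat" where
  "rad l = \<Prod>(prime_factors l)"

definition rad_without :: "nat \<Rightarrow> nat \<Rightarrow> nat" where
  "rad_without p l = \<Prod>(prime_factors l - {p})"

lemma prime_prod_dvd:
  fixes P :: "nat set"
  assumes "finite P" "\<And>p. p \<in> P \<Longrightarrow> prime p" "\<And>p. p \<in> P \<Longrightarrow> p dvd j"
  shows "\<Prod>P dvd j"
  using assms
proof (induction rule: finite_induct)
  case (insert p P)
  have "coprime p (\<Prod>P)"
    by (rule prod_coprime_right) (use insert in \<open>auto intro: primes_coprime\<close>)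
  then show ?case using insert by (simp add: divides_mult)
qed simp

lemma prime_dvd_prod_primes_iff:
  fixes P :: "nat set"
  assumes "finite P" "\<And>p. p \<in> P \<Longrightarrow> prime p" "prime q"
  shows "q dvd \<Prod>P \<longleftrightarrow> q \<in> P"
  using assms by (metis dvd_prod_eqI prime_dvd_prod_iff primes_dvd_imp_eq)

lemma rad_dvd: "rad l dvd l"
  unfolding rad_def by (rule prime_prod_dvd) auto

lemma rad_without_mult: "p \<in> prime_factors l \<Longrightarrow> p * rad_without p l = rad l"
  unfolding rad_def rad_without_def by (simp add: prod.remove)

lemma rad_without_pos: "0 < rad_without p l"
  unfolding rad_without_def by (intro prod_pos) (auto simp: prime_gt_0_nat in_prime_factors_iff)

lemma rad_without_less:
  assumes "p \<in> prime_factors l" shows "rad_without p l < l"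
proof -
  have "l \<noteq> 0" "1 < p" using assms prime_gt_1_nat[of p] by (auto simp: in_prime_factors_iff)
  then have "rad l \<le> l" using rad_dvd[of l] by (intro dvd_imp_le) auto
  moreover have "rad_without p l < p * rad_without p l" using \<open>1 < p\<close> rad_without_pos[of p l] by simp
  ultimately show ?thesis using rad_without_mult[OF assms] by simp
qed

lemma prime_dvd_rad_without_iff:
  assumes "p' \<in> prime_factors l"
  shows "p' dvd rad_without p l \<longleftrightarrow> p' \<noteq> p"
  unfolding rad_without_def using assms
  by (subst prime_dvd_prod_primes_iff) (auto simp: in_prime_factors_iff)

lemma card_primes_le_nth_prime:
  assumes "0 < r"
  shows "card {p::nat. prime p \<and> p \<le> nth_prime r} = r"
proof -
  have inf: "infinite {p::nat. prime p}" by (rule primes_infinite)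
  have "{p::nat. prime p \<and> p \<le> nth_prime r} = enumerate {p. prime p} ` {..<r}"
  proof (intro equalityI subsetI)
    fix p :: nat assume "p \<in> {p. prime p \<and> p \<le> nth_prime r}"
    then obtain i where i: "enumerate {p. prime p} i = p" "p \<le> enumerate {p. prime p} (r - 1)"
      using enumerate_Ex[OF inf, of p] by (auto simp: nth_prime_def)
    then have "i \<le> r - 1" using enumerate_mono_le_iff[OF inf] by blast
    then show "p \<in> enumerate {p. prime p} ` {..<r}" using i assms by force
  next
    fix p :: nat assume "p \<in> enumerate {p. prime p} ` {..<r}"
    then obtain i where i: "p = enumerate {p. prime p} i" "i < r" by auto
    then show "p \<in> {p::nat. prime p \<and> p \<le> nth_prime r}"
      using enumerate_in_set[OF inf, of i] enumerate_mono_le_iff[OF inf, of i "r - 1"]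
      by (simp add: nth_prime_def)
  qed
  then show ?thesis using inj_enumerate[OF inf] by (simp add: card_image inj_on_subset)
qed

text \<open>No set of at least \<open>r\<close> primes has a smaller product than the first \<open>r\<close> primes: in place of
  those that it misses it has at least as many primes, all beyond the \<open>r\<close>-th.\<close>
lemma card_less_if_prod_less_primorial:
  assumes "0 < r" "finite P" and P: "\<And>p. p \<in> P \<Longrightarrow> prime p" and less: "\<Prod>P < primorial (nth_prime r)"
  shows "card P < r"
proof (rule ccontr)
  assume "\<not> card P < r"
  define Q where "Q = {p. prime p \<and> p \<le> nth_prime r}"
  have finQ: "finite Q" unfolding Q_def by (rule finite_subset[of _ "{..nth_prime r}"]) auto
  have "card Q \<le> card P" using \<open>\<not> card P < r\<close> card_primes_le_nth_prime[OF assms(1)] by (simp add: Q_def)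
  then have card: "card (Q - P) \<le> card (P - Q)"
    using finQ assms(2) by (simp add: card_Diff_subset_Int Int_commute)
  have p1: "1 \<le> nth_prime r"
    using enumerate_in_set[OF primes_infinite, of "r - 1"] prime_ge_1_nat[of "nth_prime r"]
    by (simp add: nth_prime_def)
  have "\<Prod>(Q - P) \<le> (\<Prod>p\<in>Q - P. nth_prime r)" by (intro prod_mono) (auto simp: Q_def)
  also have "\<dots> = nth_prime r ^ card (Q - P)" by simp
  also have "\<dots> \<le> nth_prime r ^ card (P - Q)" using p1 card by (intro power_increasing) auto
  also have "\<dots> = (\<Prod>p\<in>P - Q. nth_prime r)" by simp
  also have "\<dots> \<le> \<Prod>(P - Q)" using P by (intro prod_mono) (auto simp: Q_def)
  finally have "\<Prod>(Q \<inter> P) * \<Prod>(Q - P) \<le> \<Prod>(P \<inter> Q) * \<Prod>(P - Q)"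
    by (simp add: Int_commute)
  then have "\<Prod>Q \<le> \<Prod>P" using finQ assms(2)
    by (metis (no_types, lifting) prod.Int_Diff)
  then show False using less by (simp add: primorial_def Q_def)
qed

section \<open>Toggling a face at its pivot\<close>

definition gap :: "nat set \<Rightarrow> nat" where
  "gap F = Gcd ((\<lambda>f. f - Min F) ` F)"

definition steps :: "nat set \<Rightarrow> nat" where
  "steps F = (Max F - Min F) div gap F"

text \<open>The points of \<open>F\<close> that keep the gap from being a multiple of \<open>p * gap F\<close>.\<close>
definition witnesses :: "nat \<Rightarrow> nat set \<Rightarrow> nat set" where
  "witnesses p F = {f \<in> F. \<not> p * gap F dvd f - Min F}"

text \<open>The cofactor of the gap is divisible by every prime divisor of \<open>steps F\<close> except \<open>p\<close>, so among
  these primes the point is a witness for \<open>p\<close> alone.\<close>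
definition private_witness :: "nat \<Rightarrow> nat set \<Rightarrow> nat" where
  "private_witness p F = Min F + gap F * rad_without p (steps F)"

text \<open>For these primes the private witness may be added or deleted without changing the gap: if it
  belongs to \<open>F\<close>, it is not the only witness.\<close>
definition active_primes :: "nat set \<Rightarrow> nat set" where
  "active_primes F = {p \<in> prime_factors (steps F). witnesses p F \<noteq> {private_witness p F}}"

text \<open>The default exceeds every possible active prime, so faces with no active prime come last.\<close>
definition first_active :: "nat set \<Rightarrow> nat" where
  "first_active F = (if active_primes F = {} then Suc (steps F) else Min (active_primes F))"

text \<open>With no active prime left the toggled point is a witness for no prime at all. It coincides with
  \<open>Max F\<close> when \<open>steps F\<close> is squarefree; these are the faces that stay unmatched.\<close>
definition pivot :: "nat set \<Rightarrow> nat" where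
  "pivot F = (if active_primes F = {} then Min F + gap F * rad (steps F) else private_witness (Min (active_primes F)) F)"

lemma gap_dvd: "f \<in> F \<Longrightarrow> gap F dvd f - Min F"
  by (simp add: gap_def)

lemma Min_less_Max:
  fixes F :: "nat set"
  assumes "1 < card F"
  shows "finite F" "F \<noteq> {}" "Min F < Max F"
proof -
  show fin: "finite F" using assms by (meson card_ge_0_finite less_trans zero_less_one)
  show "F \<noteq> {}" using assms by auto
  then show "Min F < Max F" using fin assms
    by (metis Max_ge Min_le card_le_Suc0_iff_eq antisym_conv le_trans not_less One_nat_def)
qed

lemma gap_steps:
  assumes "1 < card F"
  shows "0 < gap F" "gap F * steps F = Max F - Min F" "0 < steps F"
proof -
  note F = Min_less_Max[OF assms]
  then have d: "gap F dvd Max F - Min F" by (intro gap_dvd Max_in)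
  show "0 < gap F" using d F(3) by (cases "gap F = 0") auto
  show "gap F * steps F = Max F - Min F" using d by (simp add: steps_def)
  then show "0 < steps F" using F(3) by (cases "steps F = 0") auto
qed

lemma witnesses_nonempty:
  assumes "1 < card F" "p \<in> prime_factors (steps F)"
  shows "witnesses p F \<noteq> {}"
proof
  assume "witnesses p F = {}"
  then have "p * gap F dvd gap F" unfolding witnesses_def gap_def
    by (intro Gcd_greatest) auto
  then show False using gap_steps(1)[OF assms(1)] assms(2)
    by (auto simp: in_prime_factors_iff)
qed

text \<open>The gap can change only to a proper multiple, hence to a multiple of \<open>p * gap F\<close> for some prime
  \<open>p\<close> dividing \<open>steps F\<close>; a witness for \<open>p\<close> other than \<open>a\<close> rules that out.\<close>
lemma toggle_preserves_shape:
  assumes F: "1 < card F" and a: "Min F < a" "a < Max F" "gap F dvd a - Min F"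
    and unsat: "\<And>p. p \<in> prime_factors (steps F) \<Longrightarrow> \<exists>f \<in> witnesses p F. f \<noteq> a"
    and F': "F - {a} \<subseteq> F'" "F' \<subseteq> insert a F"
  shows "Min F' = Min F" "Max F' = Max F" "gap F' = gap F" "steps F' = steps F"
proof -
  note fin = Min_less_Max(1)[OF F] and ne = Min_less_Max(2)[OF F]
  have finF': "finite F'" using fin F'(2) finite_subset by blast
  have mem: "Min F \<in> F'" "Max F \<in> F'" using Min_in[OF fin ne] Max_in[OF fin ne] a(1,2) F'(1) by auto
  have bounds: "Min F \<le> f \<and> f \<le> Max F" if "f \<in> F'" for f
    using that F'(2) a(1,2) fin by (metis Max_ge Min_le insertE less_imp_le subsetD)
  show Min: "Min F' = Min F" using mem bounds finF' by (intro Min_eqI) auto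
  show Max: "Max F' = Max F" using mem bounds finF' by (intro Max_eqI) auto
  have "gap F dvd gap F'" unfolding gap_def[of F'] Min
    using F'(2) a(3) gap_dvd[of _ F] by (intro Gcd_greatest) auto
  then obtain h where h: "gap F' = gap F * h" by blast
  have "h = 1"
  proof (rule ccontr)
    assume "h \<noteq> 1"
    then obtain p where p: "prime p" "p dvd h" using prime_factor_nat by blast
    have dvd: "p * gap F dvd f - Min F" if "f \<in> F'" for f
    proof -
      have "p * gap F dvd gap F'" using p(2) by (simp add: h mult.commute)
      then show ?thesis using gap_dvd[OF that] Min by (metis dvd_trans)
    qed
    have "gap F * p dvd gap F * steps F" using dvd[OF mem(2)] gap_steps(2)[OF F] by (simp add: mult.commute)
    then have "p dvd steps F" using gap_steps(1)[OF F] nat_mult_dvd_cancel1 by blast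
    then have "p \<in> prime_factors (steps F)" using gap_steps[OF F] p(1) by (simp add: in_prime_factors_iff)
    then obtain f where "f \<in> witnesses p F" "f \<noteq> a" using unsat by blast
    then show False using dvd[of f] F'(1) by (auto simp: witnesses_def)
  qed
  then show gap: "gap F' = gap F" using h by simp
  show "steps F' = steps F" unfolding steps_def Min Max gap ..
qed

lemma active_primes_le:
  assumes "0 < steps F" "p \<in> active_primes F" shows "p \<le> steps F"
  using assms by (auto simp: active_primes_def in_prime_factors_iff dvd_imp_le)

lemma finite_active_primes: "finite (active_primes F)" by (simp add: active_primes_def)

lemma private_witness_between:
  assumes F: "1 < card F" and p: "p \<in> prime_factors (steps F)"
  shows "Min F < private_witness p F" "private_witness p F < Max F"
proof -
  note g = gap_steps[OF F]
  have "gap F * rad_without p (steps F) < gap F * steps F" using g(1) rad_without_less[OF p] by (rule mult_strict_left_mono[rotated])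
  then show "private_witness p F < Max F" unfolding g(2) by (simp add: private_witness_def)
  show "Min F < private_witness p F" using g(1) rad_without_pos by (simp add: private_witness_def)
qed

lemma pivot_is_witness_imp:
  assumes F: "1 < card F" and p: "p \<in> prime_factors (steps F)"
    and piv: "p * gap F dvd pivot F - Min F \<Longrightarrow> False"
  shows "p \<in> active_primes F \<and> pivot F = private_witness p F"
proof (cases "active_primes F = {}")
  case True
  have "p dvd rad (steps F)" using p rad_without_mult[OF p] by (metis dvd_triv_left)
  then show ?thesis using piv True by (simp add: pivot_def mult.commute)
next
  case False
  define p0 where "p0 = Min (active_primes F)"
  have p0: "p0 \<in> active_primes F" using False finite_active_primes unfolding p0_def by (intro Min_in)
  have "p = p0"
  proof (rule ccontr)
    assume "p \<noteq> p0"
    then have "p dvd rad_without p0 (steps F)" using prime_dvd_rad_without_iff[OF p] by simp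
    then show False using piv False by (simp add: pivot_def private_witness_def p0_def mult.commute)
  qed
  then show ?thesis using p0 False by (simp add: pivot_def p0_def)
qed

text \<open>The pivot is a witness for at most one prime, and if it is one for \<open>p\<close> then \<open>p\<close> is active, so a
  second witness for \<open>p\<close> survives the toggle. Hence neither the shape nor the active primes change,
  and toggling again restores \<open>F\<close>.\<close>
lemma toggle_pivot:
  assumes F: "1 < card F" and piv: "Min F < pivot F" "pivot F < Max F"
    and F': "F - {pivot F} \<subseteq> F'" "F' \<subseteq> insert (pivot F) F"
  shows "Min F' = Min F" "Max F' = Max F" "gap F' = gap F" "active_primes F' = active_primes F"
proof -
  have unsat: "\<exists>f \<in> witnesses p F. f \<noteq> pivot F" if p: "p \<in> prime_factors (steps F)" for p
  proof (cases "p * gap F dvd pivot F - Min F")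
    case True
    then show ?thesis using witnesses_nonempty[OF F p] by (auto simp: witnesses_def)
  next
    case False
    then have "p \<in> active_primes F" "pivot F = private_witness p F" using pivot_is_witness_imp[OF F p] by auto
    then show ?thesis using witnesses_nonempty[OF F p] by (auto simp: active_primes_def)
  qed
  have dvd: "gap F dvd pivot F - Min F" by (simp add: pivot_def private_witness_def)
  have eqs: "Min F' = Min F" "Max F' = Max F" "gap F' = gap F" "steps F' = steps F"
    by (rule toggle_preserves_shape[OF F piv dvd _ F']; use unsat in blast)+
  then show "Min F' = Min F" "Max F' = Max F" "gap F' = gap F" by blast+
  have private_witness: "private_witness p F' = private_witness p F" for p by (simp add: private_witness_def eqs)
  have "witnesses p F' = {private_witness p F} \<longleftrightarrow> witnesses p F = {private_witness p F}"
    if p: "p \<in> prime_factors (steps F)" for p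
  proof (cases "p * gap F dvd pivot F - Min F")
    case True
    then have "witnesses p F' = witnesses p F" using F' by (auto simp: witnesses_def eqs)
    then show ?thesis by simp
  next
    case False
    then have "p \<in> active_primes F" "pivot F = private_witness p F" using pivot_is_witness_imp[OF F p] by auto
    moreover obtain f where f: "f \<in> witnesses p F" "f \<noteq> pivot F" using unsat[OF p] by blast
    moreover have "f \<in> witnesses p F'" using f F'(1) by (auto simp: witnesses_def eqs)
    ultimately show ?thesis by auto
  qed
  then show "active_primes F' = active_primes F" unfolding active_primes_def private_witness eqs(4) by (intro Collect_cong) blast
qed

text \<open>A point of \<open>F\<close> that is a witness for no prime has an offset divisible by
  \<open>gap F * rad (steps F) = Max F - Min F\<close>, so it is an end point; every other point is one of the
  private witnesses.\<close>
lemma card_le_if_no_active_primes: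
  assumes F: "1 < card F" and st: "active_primes F = {}" and rad: "rad (steps F) = steps F"
  shows "card F \<le> card (prime_factors (steps F)) + 2"
proof -
  note fin = Min_less_Max[OF F] and gap = gap_steps[OF F]
  have "F \<subseteq> {Min F, Max F} \<union> (\<lambda>p. private_witness p F) ` prime_factors (steps F)"
  proof
    fix f assume f: "f \<in> F"
    then obtain j where j: "f - Min F = gap F * j" using gap_dvd by (metis dvdE)
    have ge: "Min F \<le> f" "f \<le> Max F" using f fin(1) by auto
    show "f \<in> {Min F, Max F} \<union> (\<lambda>p. private_witness p F) ` prime_factors (steps F)"
    proof (cases "\<exists>p\<in>prime_factors (steps F). f \<in> witnesses p F")
      case True
      then show ?thesis using st by (auto simp: active_primes_def)
    next
      case False
      then have "p dvd j" if "p \<in> prime_factors (steps F)" for p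
        using that f gap(1) by (auto simp: witnesses_def j mult.commute[of p])
      then have "rad (steps F) dvd j" unfolding rad_def by (intro prime_prod_dvd) auto
      then have "steps F dvd j" using rad by simp
      then obtain i where i: "j = steps F * i" by blast
      have fi: "f - Min F = (Max F - Min F) * i" using j i gap(2) by (simp add: mult.assoc[symmetric])
      moreover have "f - Min F \<le> Max F - Min F" using ge by simp
      ultimately have "(Max F - Min F) * i \<le> (Max F - Min F) * 1" by simp
      then have "i \<le> 1" using fin(3) by (subst (asm) mult_le_cancel1) auto
      then have "i = 0 \<or> i = 1" by auto
      then show ?thesis using fi ge fin(3) by auto
    qed
  qed
  then have "card F \<le> card ({Min F, Max F} \<union> (\<lambda>p. private_witness p F) ` prime_factors (steps F))"
    by (intro card_mono) auto
  also have "\<dots> \<le> card {Min F, Max F} + card ((\<lambda>p. private_witness p F) ` prime_factors (steps F))"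
    by (rule card_Un_le)
  also have "\<dots> \<le> 2 + card (prime_factors (steps F))"
    by (intro add_mono card_image_le) (auto simp: card_insert_if)
  finally show ?thesis by simp
qed

lemma pivot_between:
  assumes F: "1 < card F" and large: "card (prime_factors (steps F)) + 2 < card (insert (pivot F) F)"
  shows "Min F < pivot F" "pivot F < Max F"
proof -
  note fin = Min_less_Max[OF F] and gap = gap_steps[OF F]
  have "Min F < pivot F \<and> pivot F < Max F"
  proof (cases "active_primes F = {}")
    case False
    then have "Min (active_primes F) \<in> active_primes F" by (intro Min_in finite_active_primes)
    then have "Min (active_primes F) \<in> prime_factors (steps F)" by (simp add: active_primes_def)
    then show ?thesis using private_witness_between[OF F] False by (simp add: pivot_def)
  next
    case True
    have le: "rad (steps F) \<le> steps F" using gap(3) by (intro dvd_imp_le rad_dvd)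
    have pos: "0 < rad (steps F)" using rad_dvd[of "steps F"] gap(3) by (cases "rad (steps F) = 0") auto
    have "rad (steps F) \<noteq> steps F"
    proof
      assume eq: "rad (steps F) = steps F"
      then have "pivot F = Max F" using gap(2) fin(3) by (simp add: pivot_def True)
      then have "insert (pivot F) F = F" using fin by (simp add: insert_absorb)
      then show False using large card_le_if_no_active_primes[OF F True eq] by simp
    qed
    then have "gap F * rad (steps F) < gap F * steps F" using le gap(1) by simp
    then show ?thesis using gap fin(3) pos by (simp add: pivot_def True)
  qed
  then show "Min F < pivot F" "pivot F < Max F" by auto
qed

section \<open>The order in which faces are removed\<close>

text \<open>A positional encoding, in base \<open>n + 1\<close>, of the lexicographic order on the width of the face, the
  fineness of its gap and the earliness of its first active prime. The subtractions are exact for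
  faces with at least two points inside \<open>{1..n}\<close>.\<close>
definition weight :: "nat \<Rightarrow> nat set \<Rightarrow> nat" where
  "weight n F = ((Max F - Min F) * Suc n + (n - gap F)) * Suc n + (n - first_active F)"

lemma lex_less:
  fixes a b N :: nat
  assumes "a < b" "c < N" shows "a * N + c < b * N + d"
proof -
  have "Suc a * N \<le> b * N" using assms(1) by (intro mult_le_mono1) simp
  then show ?thesis using assms(2) by simp
qed

lemma lex_le:
  fixes a b N :: nat
  assumes "a \<le> b" "a = b \<Longrightarrow> c \<le> d" "c < N"
  shows "a * N + c \<le> b * N + d" "a * N + c = b * N + d \<Longrightarrow> a = b \<and> c = d"
  using lex_less[of a b c N d] assms by (cases "a = b"; force)+

lemma same_span_imp:
  fixes F G :: "nat set"
  assumes "1 < card F" "finite G" "F \<subseteq> G" "Max G - Min G \<le> Max F - Min F"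
  shows "Min G = Min F" "Max G = Max F"
proof -
  note F = Min_less_Max[OF assms(1)]
  have "Min G \<le> Min F" "Max F \<le> Max G" using Min_antimono Max_mono assms(2,3) F(2) by auto
  then show "Min G = Min F" "Max G = Max F" using assms(4) F(3) by linarith+
qed

text \<open>Witnesses of \<open>F\<close> remain witnesses in a larger face of the same shape, so a second one stays
  available.\<close>
lemma active_primes_mono:
  assumes "1 < card F" "F \<subseteq> G" "Min G = Min F" "gap G = gap F" "steps G = steps F"
  shows "active_primes F \<subseteq> active_primes G"
proof
  fix p assume p: "p \<in> active_primes F"
  then have pf: "p \<in> prime_factors (steps F)" "witnesses p F \<noteq> {private_witness p F}" by (auto simp: active_primes_def)
  then obtain f where "f \<in> witnesses p F" "f \<noteq> private_witness p F"
    using witnesses_nonempty[OF assms(1) pf(1)] by blast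
  then have "f \<in> witnesses p G" "f \<noteq> private_witness p G" using assms by (auto simp: witnesses_def private_witness_def)
  then show "p \<in> active_primes G" using pf(1) assms(5) by (auto simp: active_primes_def)
qed

lemma first_active_le:
  assumes "0 < steps F" shows "first_active F \<le> Suc (steps F)"
proof (cases "active_primes F = {}")
  case False
  then have "Min (active_primes F) \<le> steps F"
    by (intro active_primes_le[OF assms] Min_in finite_active_primes)
  then show ?thesis by (simp add: first_active_def)
qed (simp add: first_active_def)

text \<open>Enlarging a face widens its interval; if the interval stays the same, the gap can only be
  refined; if that stays the same too, primes can only become active. When nothing changes, the pivot is
  determined by the data that the weight records.\<close>
lemma weight_mono:
  assumes F: "1 < card F" and G: "finite G" "F \<subseteq> G" "0 < Min G" "Max G \<le> n"
  shows "weight n F \<le> weight n G" "weight n F = weight n G \<Longrightarrow> pivot F = pivot G"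
proof -
  note fF = Min_less_Max[OF F]
  have cG: "1 < card G" using F card_mono[OF G(1,2)] by simp
  note fG = Min_less_Max[OF cG]
  note gF = gap_steps[OF F] and gG = gap_steps[OF cG]
  have lens: "Min G \<le> Min F" "Max F \<le> Max G" using Min_antimono Max_mono G fF(2) by auto
  have le: "steps H < n \<and> gap H < n" if "1 < card H" "0 < Min H" "Max H \<le> n" for H
  proof -
    note g = gap_steps[OF that(1)]
    have "steps H \<le> gap H * steps H" "gap H \<le> gap H * steps H" using g(1,3) by simp_all
    then show ?thesis using g(2) Min_less_Max(3)[OF that(1)] that by linarith
  qed
  have lF: "steps F < n \<and> gap F < n" using le[OF F] G lens by simp
  have lG: "steps G < n \<and> gap G < n" using le[OF cG] G by simp
  have stF: "first_active F \<le> n" and stG: "first_active G \<le> n"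
    using first_active_le[OF gF(3)] first_active_le[OF gG(3)] lF lG by auto
  have gap_le: "gap G \<le> gap F" if "Min G = Min F"
  proof -
    have "gap G dvd gap F" unfolding gap_def[of F] using G(2) gap_dvd[of _ G] that
      by (intro Gcd_greatest) auto
    then show ?thesis using gF(1) by (rule dvd_imp_le)
  qed
  have span: "Max F - Min F \<le> Max G - Min G" using lens by simp
  have gap: "n - gap F \<le> n - gap G" if "Max F - Min F = Max G - Min G"
    using gap_le[OF same_span_imp(1)[OF F G(1,2)]] that by (intro diff_le_mono2) simp
  note lex1 = lex_le[OF span gap, of "Suc n"]
  have eq: "Min G = Min F \<and> Max G = Max F \<and> gap G = gap F \<and> steps G = steps F"
    if "(Max F - Min F) * Suc n + (n - gap F) = (Max G - Min G) * Suc n + (n - gap G)"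
  proof -
    have "(Max F - Min F) = (Max G - Min G) \<and> n - gap F = n - gap G"
      by (rule lex1(2)) (use that in auto)
    then have same: "Max G - Min G \<le> Max F - Min F" "gap G = gap F" using lF lG by linarith+
    note ends = same_span_imp[OF F G(1,2) same(1)]
    show ?thesis by (intro conjI ends same(2)) (simp only: steps_def ends same(2))
  qed
  have first_active: "n - first_active F \<le> n - first_active G"
    if "(Max F - Min F) * Suc n + (n - gap F) = (Max G - Min G) * Suc n + (n - gap G)"
  proof -
    note e = eq[OF that]
    have sub: "active_primes F \<subseteq> active_primes G" using active_primes_mono[OF F G(2)] e by simp
    have "first_active G \<le> first_active F"
    proof (cases "active_primes F = {}")
      case True
      then show ?thesis using first_active_le[OF gG(3)] e by (simp add: first_active_def[of F])
    next
      case False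
      then show ?thesis using sub Min_antimono[OF sub False finite_active_primes] by (auto simp: first_active_def)
    qed
    then show ?thesis by simp
  qed
  note lex2 = lex_le[OF lex1(1) first_active, of "Suc n"]
  show "weight n F \<le> weight n G" unfolding weight_def using lex2(1) by simp
  assume "weight n F = weight n G"
  then have w: "(Max F - Min F) * Suc n + (n - gap F) = (Max G - Min G) * Suc n + (n - gap G)"
    "n - first_active F = n - first_active G" using lex2(2) by (auto simp: weight_def)
  note e = eq[OF w(1)]
  have st: "first_active F = first_active G" using w(2) stF stG by simp
  have "Min (active_primes H) \<noteq> Suc (steps H)" if "active_primes H \<noteq> {}" "0 < steps H" for H
    using active_primes_le[OF that(2) Min_in[OF finite_active_primes that(1)]] by simp
  then have "active_primes F = {} \<longleftrightarrow> active_primes G = {}" "active_primes F \<noteq> {} \<Longrightarrow> Min (active_primes F) = Min (active_primes G)"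
    using st e gF(3) unfolding first_active_def by (metis)+
  then show "pivot F = pivot G" using e by (auto simp: pivot_def private_witness_def)
qed

section \<open>Collapsing the van der Waerden complex\<close>

lemma finite_complex_vdW: "finite_complex (vdW n k)"
proof -
  have sub: "F \<subseteq> {1..n}" if "F \<in> vdW n k" for F
  proof -
    have "{x + j * d | j. j \<le> k} \<subseteq> {1..n}" if "1 \<le> x" "x + k * d \<le> n" for x d
    proof
      fix y assume "y \<in> {x + j * d | j. j \<le> k}"
      then obtain j where j: "y = x + j * d" "j \<le> k" by blast
      have "j * d \<le> k * d" using j(2) by (rule mult_le_mono1)
      then have "y \<le> n" using j(1) that(2) by linarith
      then show "y \<in> {1..n}" using j(1) that(1) by simp
    qed
    then show ?thesis using that unfolding vdW_def by blast
  qed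
  have "G \<in> vdW n k" if "F \<in> vdW n k" "G \<subseteq> F" for F G
  proof -
    have "F = {} \<or> (\<exists>i. F = {i} \<and> i \<in> {1..n}) \<or> (\<exists>x d. 0 < d \<and> 1 \<le> x \<and> x < x + k * d \<and> x + k * d \<le> n \<and>
        F \<subseteq> {x + j * d | j. j \<le> k})"
      using that(1) unfolding vdW_def Un_iff mem_Collect_eq singleton_iff by (elim disjE) simp_all
    then show ?thesis
    proof (elim disjE exE conjE)
      fix x d assume xd: "0 < d" "1 \<le> x" "x < x + k * d" "x + k * d \<le> n" "F \<subseteq> {x + j * d | j. j \<le> k}"
      have "G \<subseteq> {x + j * d | j. j \<le> k}" using that(2) xd(5) by (rule subset_trans)
      then show ?thesis unfolding vdW_def Un_iff mem_Collect_eq using xd(1-4) by (intro disjI2 exI conjI)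
    qed (use that(2) in \<open>auto simp: vdW_def subset_singleton_iff\<close>)
  qed
  moreover have "finite (vdW n k)"
    using sub by (intro finite_subset[of "vdW n k" "Pow {1..n}"]) auto
  moreover have "\<forall>F\<in>vdW n k. finite F" using sub finite_subset by blast
  ultimately show ?thesis unfolding finite_complex_def by blast
qed

lemma vdW_faceE:
  assumes "F \<in> vdW n k" "1 < card F"
  obtains x d where "0 < d" "1 \<le> x" "x < x + k * d" "x + k * d \<le> n" "F \<subseteq> {x + j * d | j. j \<le> k}"
  using assms unfolding vdW_def by auto

text \<open>The difference \<open>d\<close> of a progression through \<open>F\<close> divides the gap, so every point between the ends
  of \<open>F\<close> that lies on the grid of width \<open>gap F\<close> lies on the same progression.\<close>
lemma vdW_face_gap:
  assumes F: "F \<in> vdW n k" "1 < card F"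
  shows "Min F \<ge> 1" "Max F \<le> n" "steps F \<le> k"
    and "\<And>j. j \<le> steps F \<Longrightarrow> insert (Min F + gap F * j) F \<in> vdW n k"
proof -
  obtain x d where xd: "0 < d" "1 \<le> x" "x < x + k * d" "x + k * d \<le> n" "F \<subseteq> {x + j * d | j. j \<le> k}"
    using vdW_faceE[OF F] .
  note fin = Min_less_Max[OF F(2)]
  note gap = gap_steps[OF F(2)]
  obtain a where a: "Min F = x + a * d" "a \<le> k" using Min_in[OF fin(1,2)] xd(5) by blast
  obtain b where b: "Max F = x + b * d" "b \<le> k" using Max_in[OF fin(1,2)] xd(5) by blast
  show "Min F \<ge> 1" using a xd by simp
  have "b * d \<le> k * d" using b(2) by (rule mult_le_mono1)
  then show "Max F \<le> n" using b(1) xd(4) by linarith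
  have "d dvd gap F" unfolding gap_def
  proof (rule Gcd_greatest)
    fix y assume "y \<in> (\<lambda>f. f - Min F) ` F"
    then obtain c where "y = (x + c * d) - (x + a * d)" using xd(5) a by auto
    then have "y = (c - a) * d" by (simp add: diff_mult_distrib)
    then show "d dvd y" by simp
  qed
  then obtain e where e: "gap F = d * e" by blast
  then have e0: "0 < e" using gap(1) by (cases e) auto
  have "d * (e * steps F) = gap F * steps F" by (simp add: e)
  also have "\<dots> = b * d - a * d" using gap(2) a(1) b(1) by simp
  also have "\<dots> = d * (b - a)" unfolding diff_mult_distrib2 mult.commute[of d] ..
  finally have "d * (e * steps F) = d * (b - a)" .
  then have ba: "e * steps F = b - a" using xd(1) by simp
  then have "steps F \<le> b - a" using e0 by (metis One_nat_def Suc_leI mult_le_mono1 nat_mult_1)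
  then show "steps F \<le> k" using b by simp
  fix j assume j: "j \<le> steps F"
  have "e * j \<le> b - a" using j ba by (metis mult_le_mono2)
  moreover have "a \<le> b" using fin(3) a b xd(1) by simp
  ultimately have "a + e * j \<le> k" using b by simp
  moreover have "Min F + gap F * j = x + (a + e * j) * d" using a e by (simp add: algebra_simps)
  ultimately have "insert (Min F + gap F * j) F \<subseteq> {x + j * d | j. j \<le> k}" using xd(5) by blast
  then show "insert (Min F + gap F * j) F \<in> vdW n k" using xd unfolding vdW_def by blast
qed

theorem theorem3p8:
  fixes n k r :: nat
  assumes "0 < n" and "0 < k" and "0 < r"
    and "k < primorial (nth_prime r)"
  shows "\<exists>(Y :: (nat \<Rightarrow> real) topology) C dm.
           CW_structure Y C dm \<and> (\<forall>e\<in>C. dm e \<le> r) \<and>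
           geometric_realization (vdW n k) homotopy_equivalent_space Y"
proof -
  define K where "K = vdW n k"
  \<comment> \<open>Both members of a pair lie in \<open>U\<close> together: the condition speaks of the larger one.\<close>
  define U where "U = {F \<in> K. r + 2 \<le> card (insert (pivot F) F)}"
  have K: "finite_complex K" unfolding K_def by (rule finite_complex_vdW)
  have fin: "finite F" if "F \<in> K" for F using K that by (simp add: finite_complex_def)
  have card_U: "1 < card F" "r + 1 \<le> card F" if "F \<in> U" for F
  proof -
    have "r + 2 \<le> card (insert (pivot F) F)" using that by (simp add: U_def)
    also have "\<dots> \<le> Suc (card F)" by (rule card_insert_le_m1) auto
    finally show "1 < card F" "r + 1 \<le> card F" using assms(3) by auto
  qed
  have between: "Min F < pivot F" "pivot F < Max F" if "F \<in> U" for F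
  proof -
    have c: "1 < card F" and FK: "F \<in> vdW n k" using card_U that by (auto simp: U_def K_def)
    have pos: "0 < steps F" using gap_steps[OF c] by simp
    have "\<Prod>(prime_factors (steps F)) \<le> steps F" using rad_dvd[of "steps F"] pos
      unfolding rad_def by (rule dvd_imp_le)
    also have "\<dots> < primorial (nth_prime r)" using vdW_face_gap(3)[OF FK c] assms(4) by simp
    finally have "card (prime_factors (steps F)) < r"
      by (intro card_less_if_prod_less_primorial assms(3)) auto
    then have "card (prime_factors (steps F)) + 2 < card (insert (pivot F) F)"
      using that by (simp add: U_def)
    then show "Min F < pivot F" "pivot F < Max F" using pivot_between[OF c] by auto
  qed
  have ins_K: "insert (pivot F) F \<in> K" if F: "F \<in> U" for F
  proof -
    have c: "1 < card F" and FK: "F \<in> vdW n k" using card_U F by (auto simp: U_def K_def)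
    obtain j where j: "pivot F = Min F + gap F * j"
      unfolding pivot_def private_witness_def by (cases "active_primes F = {}") auto
    then have "gap F * j < gap F * steps F" using between[OF F] gap_steps[OF c] by simp
    then have "j \<le> steps F" by simp
    then show ?thesis using vdW_face_gap(4)[OF FK c] j by (simp add: K_def)
  qed
  have toggle: "F' \<in> U \<and> weight n F' = weight n F \<and> pivot F' = pivot F"
    if F: "F \<in> U" and F': "F - {pivot F} \<subseteq> F'" "F' \<subseteq> insert (pivot F) F" for F F'
  proof -
    note eq = toggle_pivot[OF card_U(1)[OF F] between[OF F] F']
    have st: "steps F' = steps F" by (simp add: steps_def eq)
    have piv: "pivot F' = pivot F" by (simp add: pivot_def private_witness_def st eq)
    have "F' \<in> K" using ins_K[OF F] F'(2) K unfolding finite_complex_def by blast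
    moreover have "insert (pivot F) F' = insert (pivot F) F" using F' by blast
    ultimately have "F' \<in> U" using F by (simp add: U_def piv)
    then show ?thesis using piv by (simp add: weight_def first_active_def st eq)
  qed
  have L: "finite_complex (K - U) \<and> geometric_realization K homotopy_equivalent_space geometric_realization (K - U)"
  proof (rule matching_collapse[where w = "weight n" and t = pivot, OF K])
    show "U \<subseteq> K" by (auto simp: U_def)
    show "G \<in> U" if "F \<in> U" "G \<in> K" "F \<subseteq> G" for F G
    proof (cases "F = G")
      case False
      then have "card F < card G" using that fin by (intro psubset_card_mono) auto
      moreover have "card G \<le> card (insert (pivot G) G)" using fin[OF that(2)] by (intro card_mono) auto
      ultimately show ?thesis using card_U(2)[OF that(1)] that(2) by (simp add: U_def)
    qed (use that in simp)
    show "insert (pivot F) F \<in> U \<and> weight n (insert (pivot F) F) = weight n F \<and> pivot (insert (pivot F) F) = pivot F"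
      if "F \<in> U" for F using that by (intro toggle) auto
    show "F - {pivot F} \<in> U \<and> weight n (F - {pivot F}) = weight n F \<and> pivot (F - {pivot F}) = pivot F"
      if "F \<in> U" for F using that by (intro toggle) auto
    show "weight n F \<le> weight n G" "weight n F = weight n G \<Longrightarrow> pivot F = pivot G"
      if "F \<in> U" "G \<in> U" "F \<subseteq> G" for F G
    proof -
      have G: "G \<in> vdW n k" using that by (auto simp: U_def K_def)
      have "0 < Min G" "Max G \<le> n" using vdW_face_gap(1,2)[OF G card_U(1)[OF that(2)]] by auto
      moreover have "finite G" using G fin by (simp add: K_def)
      ultimately show "weight n F \<le> weight n G" "weight n F = weight n G \<Longrightarrow> pivot F = pivot G"
        using weight_mono[OF card_U(1)[OF that(1)]] that(3) by auto
    qed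
    show "{} \<notin> U" using card_U(1)[of "{}"] by auto
  qed
  have "simplex_dim e \<le> r" if e: "e \<in> open_simplex ` (K - U - {{}})" for e
  proof -
    obtain F where F: "F \<in> K" "F \<notin> U" "F \<noteq> {}" "e = open_simplex F" using e by blast
    have "card F \<le> card (insert (pivot F) F)" using fin[OF F(1)] by (intro card_mono) auto
    then have "card F \<le> r + 1" using F by (simp add: U_def)
    then show ?thesis using F fin[OF F(1)] by (simp add: simplex_dim_open_simplex)
  qed
  then have dims: "\<forall>e\<in>open_simplex ` (K - U - {{}}). simplex_dim e \<le> r" by (rule ballI)
  show ?thesis
    unfolding K_def[symmetric]
    by (intro exI conjI) (rule CW_structure_geometric_realization[OF conjunct1[OF L]], rule dims, rule conjunct2[OF L])
qed

end
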